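(* For all computations $M,N$ of $\lambda_{\copyright}$: if $M \to_{\copyright}^* N$, then there exists a computation $L$ such that $M (\to^{\mathsf s}_{\copyright})^* L$ and $L (\to^{\neg\mathsf s}_{\copyright})^* N$.
   Context: The computational core $\lambda_{\copyright}$ has values $V,W ::= x \mid \lambda x.M$ and computations $M,N,L ::= \,!V \mid VM$, where $x$ ranges over a countable set of variables; terms are taken up to $\alpha$-renaming, $\mathrm{fv}$ denotes free variables and $M\{V/x\}$ capture-avoiding substitution. The rules (binary relations on computations) are: $\beta_c$: $(\lambda x.M)(!V) \mapsto M\{V/x\}$; $\mathsf{id}$: $(\lambda x.!x)M \mapsto M$; $\sigma$: $(\lambda y.N)((\lambda x.M)L) \mapsto (\lambda x.(\lambda y.N)M)L$ provided $x\notin \mathrm{fv}(N)$; and $\copyright = \beta_c\cup\mathsf{id}\cup\sigma$. Contexts: $C ::= [\,] \mid\, !(\lambda x.C) \mid VC \mid (\lambda x.C)M$; surface contexts: $S ::= [\,] \mid VS \mid (\lambda x.S)M$ (holes are filled with computations). For a rule $\rho$, $\to_\rho$ is its closure under all contexts ($C[R]\to_\rho C[R']$ whenever $R\mapsto_\rho R'$), $\to^{\mathsf s}_\rho$ is its closure under surface contexts, and $\to^{\neg\mathsf s}_\rho$ is its closure under contexts that are not surface contexts. $\to^*$ denotes reflexive–transitive closure. *)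

theory Defs
  imports Main
begin

text \<open>
  Terms up to \<alpha>-renaming are represented by de Bruijn indices: \<open>Lam M\<close> binds index \<open>0\<close> in \<open>M\<close>,
  and an index pointing beyond all enclosing binders is a free variable.
\<close>

datatype val = Var nat | Lam computation
  and computation = Ret val | App val computation

primrec lift_val :: "nat \<Rightarrow> val \<Rightarrow> val"
  and lift :: "nat \<Rightarrow> computation \<Rightarrow> computation" where
  "lift_val k (Var i) = (if i < k then Var i else Var (Suc i))"
| "lift_val k (Lam M) = Lam (lift (Suc k) M)"
| "lift k (Ret V) = Ret (lift_val k V)"
| "lift k (App V M) = App (lift_val k V) (lift k M)"

text \<open>
  \<open>subst k W M\<close> replaces index \<open>k\<close> by \<open>W\<close> and lowers the indices above \<open>k\<close>, since the binder of
  \<open>k\<close> disappears when \<open>\<beta>\<^sub>c\<close> fires.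
\<close>

primrec subst_val :: "nat \<Rightarrow> val \<Rightarrow> val \<Rightarrow> val"
  and subst :: "nat \<Rightarrow> val \<Rightarrow> computation \<Rightarrow> computation" where
  "subst_val k W (Var i) = (if i < k then Var i else if i = k then W else Var (i - 1))"
| "subst_val k W (Lam M) = Lam (subst (Suc k) (lift_val 0 W) M)"
| "subst k W (Ret V) = Ret (subst_val k W V)"
| "subst k W (App V M) = App (subst_val k W V) (subst k W M)"

inductive beta_c :: "computation \<Rightarrow> computation \<Rightarrow> bool" where
  "beta_c (App (Lam M) (Ret V)) (subst 0 V M)"

inductive id_rule :: "computation \<Rightarrow> computation \<Rightarrow> bool" where
  "id_rule (App (Lam (Ret (Var 0))) M) M"

text \<open>
  In the contractum \<open>Lam N\<close> is moved below the binder of \<open>M\<close>. Lifting it makes the index of that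
  binder not occur in it, which is the side condition \<open>x \<notin> fv(N)\<close>.
\<close>

inductive sigma :: "computation \<Rightarrow> computation \<Rightarrow> bool" where
  "sigma (App (Lam N) (App (Lam M) L)) (App (Lam (App (lift_val 0 (Lam N)) M)) L)"

definition comp_rule :: "computation \<Rightarrow> computation \<Rightarrow> bool" where
  "comp_rule M N \<longleftrightarrow> beta_c M N \<or> id_rule M N \<or> sigma M N"

text \<open>The constructors are \<open>[]\<close>, \<open>!(\<lambda>x.C)\<close>, \<open>V C\<close> and \<open>(\<lambda>x.C) M\<close>, in this order.\<close>

datatype ctx = Hole | CRetLam ctx | CArg val ctx | CBody ctx computation

text \<open>Filling captures variables, so the indices of the filler are not adjusted.\<close>

primrec fill :: "ctx \<Rightarrow> computation \<Rightarrow> computation" where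
  "fill Hole R = R"
| "fill (CRetLam C) R = Ret (Lam (fill C R))"
| "fill (CArg V C) R = App V (fill C R)"
| "fill (CBody C M) R = App (Lam (fill C R)) M"

inductive surface :: "ctx \<Rightarrow> bool" where
  "surface Hole"
| "surface S \<Longrightarrow> surface (CArg V S)"
| "surface S \<Longrightarrow> surface (CBody S M)"

definition closure_under ::
  "(ctx \<Rightarrow> bool) \<Rightarrow> (computation \<Rightarrow> computation \<Rightarrow> bool) \<Rightarrow> computation \<Rightarrow> computation \<Rightarrow> bool" where
  "closure_under P \<rho> M N \<longleftrightarrow>
     (\<exists>C R R'. P C \<and> \<rho> R R' \<and> M = fill C R \<and> N = fill C R')"

definition red :: "(computation \<Rightarrow> computation \<Rightarrow> bool) \<Rightarrow> computation \<Rightarrow> computation \<Rightarrow> bool" where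
  "red \<rho> = closure_under (\<lambda>C. True) \<rho>"

definition surface_red :: "(computation \<Rightarrow> computation \<Rightarrow> bool) \<Rightarrow> computation \<Rightarrow> computation \<Rightarrow> bool" where
  "surface_red \<rho> = closure_under surface \<rho>"

definition nonsurface_red :: "(computation \<Rightarrow> computation \<Rightarrow> bool) \<Rightarrow> computation \<Rightarrow> computation \<Rightarrow> bool" where
  "nonsurface_red \<rho> = closure_under (\<lambda>C. \<not> surface C) \<rho>"

end

theory Submission
  imports Defs
begin

text \<open>
  The proof follows Kashima's approach to standardization. The relation \<open>internal\<close> keeps the surface
  skeleton of a computation and, inside every \<open>!(\<lambda>x.P)\<close>, allows surface steps from \<open>P\<close> followed by
  \<open>internal\<close> again. Since \<open>internal\<close> preserves the skeleton, it cannot create surface redexes, so a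
  reduction step from its target can be replayed by surface steps at its source. Hence surface
  reduction followed by \<open>internal\<close> absorbs every further reduction step. Duplication of values by
  \<open>\<beta>\<^sub>c\<close> does no harm, since \<open>internal\<close> acts on all copies at once.
\<close>

section \<open>Commutation laws for lifting and substitution\<close>

lemma lift_lift:
  shows "i \<le> k \<Longrightarrow> lift_val (Suc k) (lift_val i V) = lift_val i (lift_val k V)"
    and "i \<le> k \<Longrightarrow> lift (Suc k) (lift i M) = lift i (lift k M)"
  by (induction V and M arbitrary: i k and i k) auto

lemma lift_subst:
  shows "k \<le> i \<Longrightarrow> lift_val i (subst_val k W V) = subst_val k (lift_val i W) (lift_val (Suc i) V)"
    and "k \<le> i \<Longrightarrow> lift i (subst k W M) = subst k (lift_val i W) (lift (Suc i) M)"
  by (induction V and M arbitrary: i k W and i k W) (auto simp: lift_lift)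

lemma subst_lift_lower:
  shows "i \<le> k \<Longrightarrow> subst_val (Suc k) (lift_val i W) (lift_val i V) = lift_val i (subst_val k W V)"
    and "i \<le> k \<Longrightarrow> subst (Suc k) (lift_val i W) (lift i M) = lift i (subst k W M)"
  by (induction V and M arbitrary: i k W and i k W) (auto simp: lift_lift[symmetric])

lemma subst_lift:
  shows "subst_val k W (lift_val k V) = V"
    and "subst k W (lift k M) = M"
  by (induction V and M arbitrary: k W and k W) auto

lemma subst_subst:
  shows "i \<le> k \<Longrightarrow> subst_val k W (subst_val i V U) =
           subst_val i (subst_val k W V) (subst_val (Suc k) (lift_val i W) U)"
    and "i \<le> k \<Longrightarrow> subst k W (subst i V M) =
           subst i (subst_val k W V) (subst (Suc k) (lift_val i W) M)"
  by (induction U and M arbitrary: i k V W and i k V W)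
    (auto simp: lift_lift subst_lift subst_lift_lower)

section \<open>Stability of root rules and surface steps under lifting and substitution\<close>

lemma comp_rule_cases [consumes 1, case_names beta id sigma]:
  assumes "comp_rule R R'"
  obtains M V where "R = App (Lam M) (Ret V)" "R' = subst 0 V M"
  | "R = App (Lam (Ret (Var 0))) R'"
  | N M L where "R = App (Lam N) (App (Lam M) L)"
      "R' = App (Lam (App (lift_val 0 (Lam N)) M)) L"
  using assms unfolding comp_rule_def
  by (auto elim: beta_c.cases id_rule.cases sigma.cases)

lemma comp_rule_beta: "comp_rule (App (Lam M) (Ret V)) (subst 0 V M)"
  by (simp add: comp_rule_def beta_c.intros)

lemma comp_rule_id: "comp_rule (App (Lam (Ret (Var 0))) M) M"
  by (simp add: comp_rule_def id_rule.intros)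

text \<open>The lifted abstraction is unfolded here to match the form that simplification
  produces.\<close>

lemma comp_rule_sigma:
  "comp_rule (App (Lam N) (App (Lam M) L)) (App (Lam (App (Lam (lift (Suc 0) N)) M)) L)"
  using sigma.intros[of N M L] by (simp add: comp_rule_def)

lemma comp_rule_lift: "comp_rule R R' \<Longrightarrow> comp_rule (lift k R) (lift k R')"
  by (erule comp_rule_cases)
    (auto simp: lift_subst lift_lift comp_rule_beta comp_rule_id comp_rule_sigma)

lemma comp_rule_subst:
  assumes "comp_rule R R'"
  shows "comp_rule (subst k W R) (subst k W R')"
  using assms
proof (cases rule: comp_rule_cases)
  case (sigma N M L)
  \<comment> \<open>The contractum holds \<open>N\<close> under two binders, so \<open>W\<close>
    arrives there lifted twice at \<open>0\<close>. Commuting with \<open>lift (Suc 0) N\<close>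
    needs the outer lifting at \<open>Suc 0\<close>.\<close>
  have "lift_val 0 (lift_val 0 W) = lift_val (Suc 0) (lift_val 0 W)"
    by (simp add: lift_lift)
  then show ?thesis
    using sigma comp_rule_sigma[of "subst (Suc k) (lift_val 0 W) N"]
    by (simp add: subst_lift_lower)
qed (auto simp: subst_subst comp_rule_beta comp_rule_id)

abbreviation surf :: "computation \<Rightarrow> computation \<Rightarrow> bool" where
  "surf \<equiv> surface_red comp_rule"

abbreviation nonsurf :: "computation \<Rightarrow> computation \<Rightarrow> bool" where
  "nonsurf \<equiv> nonsurface_red comp_rule"

lemma surf_root: "comp_rule R R' \<Longrightarrow> surf R R'"
  unfolding surface_red_def closure_under_def by (metis fill.simps(1) surface.intros(1))

lemma surf_arg: "surf M M' \<Longrightarrow> surf (App V M) (App V M')"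
  unfolding surface_red_def closure_under_def by (metis fill.simps(3) surface.intros(2))

lemma surf_body: "surf M M' \<Longrightarrow> surf (App (Lam M) N) (App (Lam M') N)"
  unfolding surface_red_def closure_under_def by (metis fill.simps(4) surface.intros(3))

lemma surf_induct [consumes 1, case_names root arg body]:
  assumes "surf M N"
    and root: "\<And>R R'. comp_rule R R' \<Longrightarrow> P R R'"
    and arg: "\<And>M M' V. P M M' \<Longrightarrow> P (App V M) (App V M')"
    and body: "\<And>M M' N. P M M' \<Longrightarrow> P (App (Lam M) N) (App (Lam M') N)"
  shows "P M N"
proof -
  obtain C R R' where "surface C" "comp_rule R R'" "M = fill C R" "N = fill C R'"
    using assms(1) unfolding surface_red_def closure_under_def by blast
  moreover have "P (fill C R) (fill C R')"
    using \<open>surface C\<close> by induction (auto intro: root arg body \<open>comp_rule R R'\<close>)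
  ultimately show ?thesis by simp
qed

lemma surf_lift:
  assumes "surf M N"
  shows "surf (lift k M) (lift k N)"
proof -
  from assms have "\<forall>k. surf (lift k M) (lift k N)"
    by (induction rule: surf_induct) (auto intro: surf_root surf_arg surf_body comp_rule_lift)
  then show ?thesis ..
qed

lemma surf_subst:
  assumes "surf M N"
  shows "surf (subst k W M) (subst k W N)"
proof -
  from assms have "\<forall>k W. surf (subst k W M) (subst k W N)"
    by (induction rule: surf_induct) (auto intro: surf_root surf_arg surf_body comp_rule_subst)
  then show ?thesis by blast
qed

lemma rtranclp_map:
  assumes "\<And>x y. r x y \<Longrightarrow> s (f x) (f y)" and "r\<^sup>*\<^sup>* x y"
  shows "s\<^sup>*\<^sup>* (f x) (f y)"
  using assms(2) by induction (auto intro: rtranclp.rtrancl_into_rtrancl assms(1))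

lemma surfs_arg: "surf\<^sup>*\<^sup>* M M' \<Longrightarrow> surf\<^sup>*\<^sup>* (App V M) (App V M')"
  by (rule rtranclp_map[of surf surf "App V"]) (rule surf_arg)

lemma surfs_body: "surf\<^sup>*\<^sup>* M M' \<Longrightarrow> surf\<^sup>*\<^sup>* (App (Lam M) N) (App (Lam M') N)"
  by (rule rtranclp_map[of surf surf "\<lambda>M. App (Lam M) N"]) (rule surf_body)

lemma surfs_lift: "surf\<^sup>*\<^sup>* M N \<Longrightarrow> surf\<^sup>*\<^sup>* (lift k M) (lift k N)"
  by (rule rtranclp_map[of surf surf "lift k"]) (rule surf_lift)

lemma surfs_subst: "surf\<^sup>*\<^sup>* M N \<Longrightarrow> surf\<^sup>*\<^sup>* (subst k W M) (subst k W N)"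
  by (rule rtranclp_map[of surf surf "subst k W"]) (rule surf_subst)

lemma surfs_app:
  assumes "surf\<^sup>*\<^sup>* M M'" and "surf\<^sup>*\<^sup>* N N'"
  shows "surf\<^sup>*\<^sup>* (App (Lam M) N) (App (Lam M') N')"
  using surfs_body[OF assms(1), of N] surfs_arg[OF assms(2), of "Lam M'"] by simp

section \<open>Internal reduction and its composition with surface steps\<close>

inductive internal :: "computation \<Rightarrow> computation \<Rightarrow> bool" where
  ret_var: "internal (Ret (Var i)) (Ret (Var i))"
| ret_lam: "surf\<^sup>*\<^sup>* P L \<Longrightarrow> internal L P' \<Longrightarrow> internal (Ret (Lam P)) (Ret (Lam P'))"
| app_var: "internal P P' \<Longrightarrow> internal (App (Var i) P) (App (Var i) P')"
| app_lam: "internal P P' \<Longrightarrow> internal Q Q' \<Longrightarrow> internal (App (Lam P) Q) (App (Lam P') Q')"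

inductive_cases internal_to_RetE: "internal M (Ret V)"
inductive_cases internal_to_Ret_VarE: "internal M (Ret (Var i))"
inductive_cases internal_to_App_LamE: "internal M (App (Lam P) Q)"

definition standard :: "computation \<Rightarrow> computation \<Rightarrow> bool" where
  "standard M N \<longleftrightarrow> (\<exists>L. surf\<^sup>*\<^sup>* M L \<and> internal L N)"

lemma standard_internal: "internal M N \<Longrightarrow> standard M N"
  unfolding standard_def by blast

lemma surfs_standard: "surf\<^sup>*\<^sup>* M L \<Longrightarrow> standard L N \<Longrightarrow> standard M N"
  unfolding standard_def by (meson rtranclp_trans)

lemma internal_ret_lam: "standard P P' \<Longrightarrow> internal (Ret (Lam P)) (Ret (Lam P'))"
  unfolding standard_def by (auto intro: ret_lam)

lemma standard_app_var: "standard P P' \<Longrightarrow> standard (App (Var i) P) (App (Var i) P')"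
  unfolding standard_def by (meson surfs_arg app_var)

lemma standard_app_lam:
  "standard P P' \<Longrightarrow> standard Q Q' \<Longrightarrow> standard (App (Lam P) Q) (App (Lam P') Q')"
  unfolding standard_def by (meson surfs_app app_lam)

lemma internal_refl: "internal M M"
proof -
  \<comment> \<open>Reflexivity at \<open>Ret (Lam P)\<close> does not directly give
    \<open>internal P P\<close>, which \<open>app_lam\<close> needs, so the claim for values also
    covers head position.\<close>
  have "internal (Ret V) (Ret V) \<and> (\<forall>P. internal P P \<longrightarrow> internal (App V P) (App V P))"
    and "internal M M" for V
    by (induction V and M) (auto intro: internal.intros)
  then show ?thesis by blast
qed

lemma internal_lift: "internal M N \<Longrightarrow> internal (lift k M) (lift k N)"
  by (induction arbitrary: k rule: internal.induct) (auto intro: internal.intros surfs_lift)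

lemma internal_lift_val:
  "internal (Ret V) (Ret V') \<Longrightarrow> internal (Ret (lift_val k V)) (Ret (lift_val k V'))"
  using internal_lift[of "Ret V" "Ret V'" k] by simp

text \<open>The body of a returned abstraction may take surface steps. In head position that body is
  a surface position, so these steps come out in front and the result is only
  \<open>standard\<close>.\<close>

lemma standard_app_val:
  assumes "internal (Ret V) (Ret V')" and "standard P P'"
  shows "standard (App V P) (App V' P')"
  using assms(1)
  by (cases rule: internal.cases)
    (use assms(2) in
      \<open>auto intro: standard_app_var standard_app_lam surfs_standard standard_internal\<close>)

text \<open>The skeleton can change only where the substituted variable is the head of an
  application; there \<open>standard_app_val\<close> releases the surface steps stored in
  \<open>V\<close>. Hence \<open>standard\<close> rather than \<open>internal\<close>.\<close>

lemma standard_subst: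
  assumes "internal M N" and "internal (Ret V) (Ret V')"
  shows "standard (subst k V M) (subst k V' N)"
  using assms
proof (induction arbitrary: k V V' rule: internal.induct)
  case (ret_var i)
  then show ?case by (auto intro: standard_internal internal.ret_var)
next
  case (ret_lam P L P')
  then have "standard (subst (Suc k) (lift_val 0 V) P) (subst (Suc k) (lift_val 0 V') P')"
    by (meson internal_lift_val surfs_subst surfs_standard)
  then show ?case by (auto intro: standard_internal internal_ret_lam)
next
  case (app_var P P' i)
  then show ?case by (auto intro: standard_app_var standard_app_val)
next
  case (app_lam P P' Q Q')
  then show ?case by (auto intro!: standard_app_lam app_lam.IH internal_lift_val)
qed

text \<open>The shape of a root redex lies entirely in the surface skeleton, so the source is a
  redex of the same rule and one surface step answers. Only \<beta> can need more surface steps,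
  through the substitution.\<close>

lemma internal_comp_rule:
  assumes "internal P P'" and "internal Q Q'" and "comp_rule (App (Lam P') Q') N"
  shows "standard (App (Lam P) Q) N"
  using assms(3)
proof (cases rule: comp_rule_cases)
  case (beta M' V')
  then obtain V where V: "Q = Ret V"
    using assms(2) by (auto elim: internal_to_RetE)
  then have "surf (App (Lam P) Q) (subst 0 V P)"
    by (simp add: surf_root comp_rule_beta)
  moreover have "standard (subst 0 V P) N"
    using beta V assms(1,2) by (auto intro: standard_subst)
  ultimately show ?thesis by (blast intro: surfs_standard)
next
  case id
  then have "P = Ret (Var 0)"
    using assms(1) by (auto elim: internal_to_Ret_VarE)
  then have "surf (App (Lam P) Q) Q"
    by (simp add: surf_root comp_rule_id)
  then show ?thesis
    using id assms(2) by (auto intro: surfs_standard standard_internal)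
next
  case (sigma N' M' L')
  then obtain M L where Q: "Q = App (Lam M) L" "internal M M'" "internal L L'"
    using assms(2) by (auto elim: internal_to_App_LamE)
  then have "surf (App (Lam P) Q) (App (Lam (App (Lam (lift (Suc 0) P)) M)) L)"
    by (simp add: surf_root comp_rule_sigma)
  moreover have "internal (App (Lam (App (Lam (lift (Suc 0) P)) M)) L) N"
    using sigma Q assms(1) by (auto intro: internal.app_lam internal_lift)
  ultimately show ?thesis by (blast intro: surfs_standard standard_internal)
qed

text \<open>A hole under \<open>Ret (Lam _)\<close> is absorbed by \<open>ret_lam\<close>; a hole
  along the skeleton leads down to a root redex of the form \<open>App (Lam _) _\<close>. No
  left-hand side is a \<open>Ret\<close> or has a variable as head, which excludes the empty context
  in the other cases.\<close>

lemma internal_fill: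
  assumes "internal M (fill C R)" and "comp_rule R R'"
  shows "standard M (fill C R')"
  using assms(1)
proof (induction M "fill C R" arbitrary: C rule: internal.induct)
  case (ret_var i)
  then show ?case
    using assms(2) by (cases C) (auto elim: comp_rule_cases)
next
  case (ret_lam P L P')
  show ?case
  proof (cases C)
    case (CRetLam C')
    then have "standard P (fill C' R')"
      using ret_lam by (auto intro: surfs_standard)
    then show ?thesis
      using CRetLam by (auto intro: standard_internal internal_ret_lam)
  qed (use ret_lam assms(2) in \<open>auto elim: comp_rule_cases\<close>)
next
  case (app_var P P' i)
  then show ?case
    using assms(2) by (cases C) (auto elim: comp_rule_cases intro: standard_app_var)
next
  case (app_lam P P' Q Q')
  show ?case
  proof (cases C)
    case Hole
    then show ?thesis
      using app_lam assms(2) by (auto intro: internal_comp_rule)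
  qed (use app_lam in \<open>auto intro: standard_app_lam standard_internal\<close>)
qed

lemma standard_red: "standard M N \<Longrightarrow> red comp_rule N N' \<Longrightarrow> standard M N'"
  unfolding red_def closure_under_def
  by (metis internal_fill standard_def surfs_standard)

section \<open>From internal to non-surface reduction\<close>

lemma nonsurf_ret_lam: "red comp_rule M N \<Longrightarrow> nonsurf (Ret (Lam M)) (Ret (Lam N))"
  unfolding red_def nonsurface_red_def closure_under_def
  by (metis ctx.distinct(1,7,9) fill.simps(2) surface.cases)

lemma nonsurf_arg: "nonsurf M M' \<Longrightarrow> nonsurf (App V M) (App V M')"
  unfolding nonsurface_red_def closure_under_def
  by (metis ctx.distinct ctx.inject fill.simps(3) surface.cases)

lemma nonsurf_body: "nonsurf M M' \<Longrightarrow> nonsurf (App (Lam M) N) (App (Lam M') N)"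
  unfolding nonsurface_red_def closure_under_def
  by (metis ctx.distinct ctx.inject fill.simps(4) surface.cases)

lemma nonsurfs_arg: "nonsurf\<^sup>*\<^sup>* M M' \<Longrightarrow> nonsurf\<^sup>*\<^sup>* (App V M) (App V M')"
  by (rule rtranclp_map[of nonsurf nonsurf "App V"]) (rule nonsurf_arg)

lemma nonsurfs_body:
  "nonsurf\<^sup>*\<^sup>* M M' \<Longrightarrow> nonsurf\<^sup>*\<^sup>* (App (Lam M) N) (App (Lam M') N)"
  by (rule rtranclp_map[of nonsurf nonsurf "\<lambda>M. App (Lam M) N"]) (rule nonsurf_body)

lemma internal_imp_nonsurfs: "internal M N \<Longrightarrow> nonsurf\<^sup>*\<^sup>* M N"
proof (induction rule: internal.induct)
  case (ret_lam P L P')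
  \<comment> \<open>Both the surface steps from \<open>P\<close> to \<open>L\<close> and the
    non-surface steps from \<open>L\<close> to \<open>P'\<close> count as arbitrary reduction, and
    under \<open>Ret (Lam _)\<close> every step is non-surface.\<close>
  have "surf \<le> red comp_rule" "nonsurf \<le> red comp_rule"
    unfolding red_def surface_red_def nonsurface_red_def closure_under_def by blast+
  then have "(red comp_rule)\<^sup>*\<^sup>* P P'"
    using ret_lam rtranclp_mono by (meson predicate2D rtranclp_trans)
  then show ?case
    by (rule rtranclp_map[of "red comp_rule" nonsurf "\<lambda>M. Ret (Lam M)", rotated])
      (rule nonsurf_ret_lam)
next
  case (app_lam P P' Q Q')
  then show ?case
    using nonsurfs_body[of P P' Q] nonsurfs_arg[of Q Q' "Lam P'"] by simp
qed (auto intro: nonsurfs_arg)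

theorem mainTheorem1:
  fixes M N :: computation
  assumes "(red comp_rule)\<^sup>*\<^sup>* M N"
  shows "\<exists>L. (surface_red comp_rule)\<^sup>*\<^sup>* M L \<and> (nonsurface_red comp_rule)\<^sup>*\<^sup>* L N"
proof -
  have "standard M N"
    \<comment> \<open>The reduction grows at its right end, and \<open>standard_red\<close> absorbs
      each new step.\<close>
    using assms by induction (auto intro: standard_internal internal_refl standard_red)
  then show ?thesis
    unfolding standard_def by (blast intro: internal_imp_nonsurfs)
qed

end
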